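(* Let $q\ge 2$ be an even integer, let $m,s$ be positive integers, let $p$ be a prime with $2\le p\le 2^s$, and let $f:\mathbb{Z}_2^m\to\mathbb{Z}_q$ be a second-order generalized Boolean function in the variables $x_0,\dots,x_{m-1}$. Suppose that the graph $G(f)$ contains distinct vertices $x_{j_0},x_{j_1},\dots,x_{j_{k-1}}$ such that, after deleting these vertices (and all edges incident with them), the resulting graph is a path on the remaining $m-k$ vertices, all of whose edges have weight $\frac{q}{2}$. Let $\gamma$ be the label of either end vertex $x_\gamma$ of this path. For $0\le t<2^k$ and $0\le\lambda<p$, let $U_t^\lambda$ and $V_t^\lambda$ be the ordered sets of $2^{k+1}$ pseudo-Boolean functions of $m+s$ variables defined from $f$, $p$, $s$, $(j_0,\dots,j_{k-1})$ and $\gamma$ as in the context. Then the set of codes $$\left\{\psi_{2^{m+s}-p2^m}(U_t^\lambda),\ \psi^*_{2^{m+s}-p2^m}(V_t^\lambda)\ :\ 0\le t<2^k,\ 0\le\lambda<p\right\}$$ forms a $(p2^{k+1},2^m)$-$\mathrm{ZCCS}_{2^{k+1}}^{p2^m}$.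
   Context: **Correlations.** For complex sequences $\mathbf{y}_1=(y_{1,0},\dots,y_{1,N-1})$ and $\mathbf{y}_2=(y_{2,0},\dots,y_{2,N-1})$ and an integer $\tau$, define $$\theta(\mathbf{y}_1,\mathbf{y}_2)(\tau)=\begin{cases}\sum_{i=0}^{N-1-\tau}y_{1,i+\tau}\,y_{2,i}^*, & 0\le\tau<N,\\ \sum_{i=0}^{N+\tau-1}y_{1,i}\,y_{2,i-\tau}^*, & -N<\tau<0,\\ 0,&\text{otherwise},\end{cases}$$ where $*$ is complex conjugation. A code is an ordered tuple of $M$ complex sequences of the same length $N$. For codes $\mathcal{S}_{\mu}=(\mathbf{s}_0^{\mu},\dots,\mathbf{s}_{M-1}^{\mu})$, set $\theta(\mathcal{S}_{\mu_1},\mathcal{S}_{\mu_2})(\tau)=\sum_{\nu=0}^{M-1}\theta(\mathbf{s}_\nu^{\mu_1},\mathbf{s}_\nu^{\mu_2})(\tau)$. **ZCCS.** A family $\{\mathcal{S}_0,\dots,\mathcal{S}_{K-1}\}$ of $K$ codes, each consisting of $M$ sequences of length $N$, is a $(K,Z)$-$\mathrm{ZCCS}_M^N$ (Z-complementary code set with zero-correlation-zone width $Z$) if $$\theta(\mathcal{S}_{\mu_1},\mathcal{S}_{\mu_2})(\tau)=\begin{cases}MN,&\tau=0,\ \mu_1=\mu_2,\\0,&0<|\tau|<Z,\ \mu_1=\mu_2,\\0,&|\tau|<Z,\ \mu_1\ne\mu_2.\end{cases}$$ In the claim the codes are indexed by the type ($U$ or $V$) together with $(t,\lambda)$, so $K=p2^{k+1}$,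 $M=2^{k+1}$, $N=p2^m$, $Z=2^m$. **Generalized Boolean functions (GBFs) and graphs.** A GBF $f:\mathbb{Z}_2^m\to\mathbb{Z}_q$ is a $\mathbb{Z}_q$-linear combination of monomials in the $\{0,1\}$-valued variables $x_0,\dots,x_{m-1}$ (products of distinct variables, including the empty product $1$). It is second-order if the highest degree of a monomial with non-zero coefficient is $2$. The graph $G(f)$ of a second-order GBF has vertices $x_0,\dots,x_{m-1}$, with an edge of weight $w$ between $x_\alpha$ and $x_\beta$ exactly when $f$ contains the term $wx_\alpha x_\beta$ with $w\neq 0$. Write $\bar x=1-x$ for $x\in\{0,1\}$, and $\tilde f(x_0,\dots,x_{m-1})=f(1-x_0,\dots,1-x_{m-1})$. **Pseudo-Boolean functions (PBFs).** A PBF is a function $\{0,1\}^n\to\mathbb{R}$. Values in $\mathbb{Z}_q$ are regarded as integers (representatives modulo $q$) when they appear in a PBF; the choice of representatives does not affect the sequences defined below. For $\lambda=0,1,\dots,p-1$ define the PBFs of the $m+s$ variables $x_0,\dots,x_{m+s-1}$ $$F^\lambda=f+\tfrac{\lambda q}{p}\left(x_m+2x_{m+1}+\cdots+2^{s-1}x_{m+s-1}\right),\qquad G^\lambda=\tilde f+\tfrac{\lambda q}{p}\left(x_m+2x_{m+1}+\cdots+2^{s-1}x_{m+s-1}\right).$$ Let $\mathbf{x}=(x_{j_0},\dots,x_{j_{k-1}})$, $\bar{\mathbf{x}}=(1-x_{j_0},\dots,1-x_{j_{k-1}})$, and let $\mathbf{t}=(t_0,\dots,t_{k-1})$ be the binary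 representation of $t$, i.e. $t=\sum_{\alpha}t_\alpha2^\alpha$. With $\cdot$ the dot product, define $$U_t^\lambda=\left\{F^\lambda+\tfrac q2\left((\mathbf{d}+\mathbf{t})\cdot\mathbf{x}+d\,x_\gamma\right):\mathbf{d}\in\{0,1\}^k,\ d\in\{0,1\}\right\},$$ $$V_t^\lambda=\left\{G^\lambda+\tfrac q2\left((\mathbf{d}+\mathbf{t})\cdot\bar{\mathbf{x}}+\bar d\,x_\gamma\right):\mathbf{d}\in\{0,1\}^k,\ d\in\{0,1\}\right\},$$ where $\bar d=1-d$. These are ordered sets, indexed by $(\mathbf{d},d)\in\{0,1\}^k\times\{0,1\}$ in one fixed order common to all $U_t^\lambda$ and $V_t^\lambda$. **Sequences.** Let $\omega_q=\exp(2\pi\sqrt{-1}/q)$, and $\omega_q^{a}=\exp(2\pi\sqrt{-1}\,a/q)$ for real $a$. For a PBF $H$ of $m+s$ variables, $\psi(H)=(\omega_q^{H_0},\omega_q^{H_1},\dots,\omega_q^{H_{2^{m+s}-1}})$, where $H_r=H(r_0,\dots,r_{m+s-1})$ with $r=\sum_{\alpha=0}^{m+s-1}r_\alpha2^\alpha$, $r_\alpha\in\{0,1\}$. The sequence $\psi_{2^{m+s}-p2^m}(H)$ is obtained from $\psi(H)$ by removing its last $2^{m+s}-p2^m$ components, so it has length $p2^m$. For an ordered set $\mathcal{C}=(H_1,\dots,H_M)$ of PBFs, $\psi_{2^{m+s}-p2^m}(\mathcal{C})=(\psi_{2^{m+s}-p2^m}(H_1),\dots,\psi_{2^{m+s}-p2^m}(H_M))$,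 and $\psi^*_{2^{m+s}-p2^m}(\mathcal{C})$ is its componentwise complex conjugate. *)

theory Defs
  imports Complex_Main "HOL-Computational_Algebra.Primes"
begin

section \<open>Correlations and Z-complementary code sets\<close>

text \<open>Sequences are lists of complex numbers, and a code is a list of sequences.\<close>

definition corr :: "complex list \<Rightarrow> complex list \<Rightarrow> int \<Rightarrow> complex" where
  "corr y1 y2 \<tau> =
     (let N = int (length y1) in
      if 0 \<le> \<tau> \<and> \<tau> < N then \<Sum>i = 0..N - 1 - \<tau>. y1 ! nat (i + \<tau>) * cnj (y2 ! nat i)
      else if - N < \<tau> \<and> \<tau> < 0 then \<Sum>i = 0..N + \<tau> - 1. y1 ! nat i * cnj (y2 ! nat (i - \<tau>))
      else 0)"

definition code_corr :: "complex list list \<Rightarrow> complex list list \<Rightarrow> int \<Rightarrow> complex" where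
  "code_corr C1 C2 \<tau> = (\<Sum>\<nu><length C1. corr (C1 ! \<nu>) (C2 ! \<nu>) \<tau>)"

text \<open>The family \<open>(C i)\<close>, \<open>i \<in> I\<close>, is a \<open>(K,Z)\<close>-ZCCS of codes with \<open>M\<close> sequences of length \<open>N\<close>.
  It is indexed by an arbitrary set \<open>I\<close> of size \<open>K\<close> instead of \<open>{0..<K}\<close>.\<close>

definition is_ZCCS ::
  "nat \<Rightarrow> nat \<Rightarrow> nat \<Rightarrow> nat \<Rightarrow> 'i set \<Rightarrow> ('i \<Rightarrow> complex list list) \<Rightarrow> bool" where
  "is_ZCCS K Z M N I C \<longleftrightarrow>
     finite I \<and> card I = K \<and>
     (\<forall>i\<in>I. length (C i) = M \<and> (\<forall>y\<in>set (C i). length y = N)) \<and>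
     (\<forall>i\<in>I. \<forall>i'\<in>I. \<forall>\<tau>.
        (\<tau> = 0 \<and> i = i' \<longrightarrow> code_corr (C i) (C i') \<tau> = of_nat (M * N)) \<and>
        (0 < \<bar>\<tau>\<bar> \<and> \<bar>\<tau>\<bar> < int Z \<and> i = i' \<longrightarrow> code_corr (C i) (C i') \<tau> = 0) \<and>
        (\<bar>\<tau>\<bar> < int Z \<and> i \<noteq> i' \<longrightarrow> code_corr (C i) (C i') \<tau> = 0))"


section \<open>Generalized Boolean functions and their graphs\<close>

text \<open>An assignment of \<open>{0,1}\<close>-values to the variables \<open>x\<^sub>0, x\<^sub>1, \<dots>\<close> is a function
  \<open>x :: nat \<Rightarrow> bool\<close>; a function of \<open>n\<close> variables only looks at \<open>x 0, \<dots>, x (n - 1)\<close>.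
  Elements of \<open>\<int>\<^sub>q\<close> are represented by the natural numbers below \<open>q\<close>. A generalized Boolean
  function in \<open>m\<close> variables is given by its coefficients: \<open>a S\<close> is the coefficient of the
  monomial \<open>\<Prod>i\<in>S. x i\<close>, for \<open>S \<subseteq> {..<m}\<close>.\<close>

definition gbf_coeffs :: "nat \<Rightarrow> nat \<Rightarrow> (nat set \<Rightarrow> nat) \<Rightarrow> bool" where
  "gbf_coeffs q m a \<longleftrightarrow> (\<forall>S. S \<subseteq> {..<m} \<longrightarrow> a S < q)"

definition gbf :: "nat \<Rightarrow> nat \<Rightarrow> (nat set \<Rightarrow> nat) \<Rightarrow> (nat \<Rightarrow> bool) \<Rightarrow> nat" where
  "gbf q m a x = (\<Sum>S\<in>Pow {..<m}. a S * (\<Prod>i\<in>S. of_bool (x i))) mod q"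

definition second_order :: "nat \<Rightarrow> (nat set \<Rightarrow> nat) \<Rightarrow> bool" where
  "second_order m a \<longleftrightarrow>
     (\<exists>S. S \<subseteq> {..<m} \<and> a S \<noteq> 0 \<and> card S = 2) \<and>
     (\<forall>S. S \<subseteq> {..<m} \<and> a S \<noteq> 0 \<longrightarrow> card S \<le> 2)"

record wgraph =
  verts :: "nat set"
  edges :: "nat set set"
  weight :: "nat set \<Rightarrow> nat"

definition gbf_graph :: "nat \<Rightarrow> (nat set \<Rightarrow> nat) \<Rightarrow> wgraph" where
  "gbf_graph m a =
     \<lparr>verts = {..<m},
      edges = {{\<alpha>, \<beta>} | \<alpha> \<beta>. \<alpha> < m \<and> \<beta> < m \<and> \<alpha> \<noteq> \<beta> \<and> a {\<alpha>, \<beta>} \<noteq> 0},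
      weight = a\<rparr>"

definition delete_verts :: "wgraph \<Rightarrow> nat set \<Rightarrow> wgraph" where
  "delete_verts G J =
     G\<lparr>verts := verts G - J, edges := {e \<in> edges G. e \<inter> J = {}}\<rparr>"

text \<open>\<open>G\<close> is a path that visits its vertices in the order \<open>vs\<close>, so its end vertices are
  \<open>hd vs\<close> and \<open>last vs\<close>. A single vertex counts as a path.\<close>

definition is_path_graph :: "wgraph \<Rightarrow> nat list \<Rightarrow> bool" where
  "is_path_graph G vs \<longleftrightarrow>
     vs \<noteq> [] \<and> distinct vs \<and> set vs = verts G \<and>
     edges G = {{vs ! i, vs ! Suc i} | i. Suc i < length vs}"


section \<open>Pseudo-Boolean functions and their sequences\<close>

type_synonym pbf = "(nat \<Rightarrow> bool) \<Rightarrow> real"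

definition F_pbf ::
  "nat \<Rightarrow> nat \<Rightarrow> nat \<Rightarrow> nat \<Rightarrow> ((nat \<Rightarrow> bool) \<Rightarrow> nat) \<Rightarrow> nat \<Rightarrow> pbf" where
  "F_pbf q p m s f l x =
     real (f x) + real l * real q / real p * (\<Sum>i<s. 2 ^ i * of_bool (x (m + i)))"

definition G_pbf ::
  "nat \<Rightarrow> nat \<Rightarrow> nat \<Rightarrow> nat \<Rightarrow> ((nat \<Rightarrow> bool) \<Rightarrow> nat) \<Rightarrow> nat \<Rightarrow> pbf" where
  "G_pbf q p m s f l x =
     real (f (\<lambda>i. \<not> x i)) + real l * real q / real p * (\<Sum>i<s. 2 ^ i * of_bool (x (m + i)))"

text \<open>The argument \<open>ord\<close> lists the pairs \<open>(\<^bold>d, d)\<close> in \<open>{0,1}\<^sup>k \<times> {0,1}\<close> in the order in which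
  they index the ordered sets \<open>U\<close> and \<open>V\<close>. The bits of \<open>t\<close> are \<open>bit t 0\<close>, \<open>bit t 1\<close>, and so on,
  least significant first.\<close>

definition index_order :: "nat \<Rightarrow> (bool list \<times> bool) list \<Rightarrow> bool" where
  "index_order k ord \<longleftrightarrow> distinct ord \<and> set ord = {ds. length ds = k} \<times> UNIV"

definition U_set ::
  "nat \<Rightarrow> nat \<Rightarrow> nat \<Rightarrow> nat \<Rightarrow> ((nat \<Rightarrow> bool) \<Rightarrow> nat) \<Rightarrow> nat \<Rightarrow> (nat \<Rightarrow> nat) \<Rightarrow> nat \<Rightarrow>
   (bool list \<times> bool) list \<Rightarrow> nat \<Rightarrow> nat \<Rightarrow> pbf list" where
  "U_set q p m s f k j \<gamma> ord t l =
     map (\<lambda>(ds, d) x. F_pbf q p m s f l x + real q / 2 *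
            ((\<Sum>\<alpha><k. (of_bool (ds ! \<alpha>) + of_bool (bit t \<alpha>)) * of_bool (x (j \<alpha>)))
             + of_bool d * of_bool (x \<gamma>))) ord"

definition V_set ::
  "nat \<Rightarrow> nat \<Rightarrow> nat \<Rightarrow> nat \<Rightarrow> ((nat \<Rightarrow> bool) \<Rightarrow> nat) \<Rightarrow> nat \<Rightarrow> (nat \<Rightarrow> nat) \<Rightarrow> nat \<Rightarrow>
   (bool list \<times> bool) list \<Rightarrow> nat \<Rightarrow> nat \<Rightarrow> pbf list" where
  "V_set q p m s f k j \<gamma> ord t l =
     map (\<lambda>(ds, d) x. G_pbf q p m s f l x + real q / 2 *
            ((\<Sum>\<alpha><k. (of_bool (ds ! \<alpha>) + of_bool (bit t \<alpha>)) * of_bool (\<not> x (j \<alpha>)))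
             + of_bool (\<not> d) * of_bool (x \<gamma>))) ord"

definition \<omega> :: "nat \<Rightarrow> real \<Rightarrow> complex" where
  "\<omega> q a = exp (2 * of_real pi * \<i> * of_real a / of_nat q)"

definition \<psi> :: "nat \<Rightarrow> nat \<Rightarrow> pbf \<Rightarrow> complex list" where
  "\<psi> q n H = map (\<lambda>r. \<omega> q (H (bit r))) [0..<2 ^ n]"

text \<open>\<open>\<psi>_trunc q n L\<close> removes the last \<open>L\<close> of the \<open>2 ^ n\<close> components.\<close>

definition \<psi>_trunc :: "nat \<Rightarrow> nat \<Rightarrow> nat \<Rightarrow> pbf \<Rightarrow> complex list" where
  "\<psi>_trunc q n L H = take (2 ^ n - L) (\<psi> q n H)"

definition \<psi>_code :: "nat \<Rightarrow> nat \<Rightarrow> nat \<Rightarrow> pbf list \<Rightarrow> complex list list" where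
  "\<psi>_code q n L Hs = map (\<psi>_trunc q n L) Hs"

definition \<psi>_code_cnj :: "nat \<Rightarrow> nat \<Rightarrow> nat \<Rightarrow> pbf list \<Rightarrow> complex list list" where
  "\<psi>_code_cnj q n L Hs = map (map cnj) (\<psi>_code q n L Hs)"

text \<open>The index \<open>Inl (t, l)\<close> stands for the code of \<open>U\<close>, and \<open>Inr (t, l)\<close> for the conjugated
  code of \<open>V\<close>.\<close>

definition code_family ::
  "nat \<Rightarrow> nat \<Rightarrow> nat \<Rightarrow> nat \<Rightarrow> ((nat \<Rightarrow> bool) \<Rightarrow> nat) \<Rightarrow> nat \<Rightarrow> (nat \<Rightarrow> nat) \<Rightarrow> nat \<Rightarrow>
   (bool list \<times> bool) list \<Rightarrow> (nat \<times> nat) + (nat \<times> nat) \<Rightarrow> complex list list" where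
  "code_family q p m s f k j \<gamma> ord =
     (let L = 2 ^ (m + s) - p * 2 ^ m in
      case_sum
        (\<lambda>(t, l). \<psi>_code q (m + s) L (U_set q p m s f k j \<gamma> ord t l))
        (\<lambda>(t, l). \<psi>_code_cnj q (m + s) L (V_set q p m s f k j \<gamma> ord t l)))"

end

theory Submission imports Defs "HOL-Analysis.Complex_Transcendental" begin

text \<open>Each sequence is a sequence of length \<open>2\<^sup>m\<close> tensored with the character
  \<open>b \<mapsto> exp (2 \<pi> i \<lambda> b / p)\<close>, so for shifts below \<open>2\<^sup>m\<close> the claim reduces to the factors of length
  \<open>2\<^sup>m\<close> and to the orthogonality of the characters. For the factors, summing over
  \<open>(\<^bold>d, d)\<close> restricts the correlation to pairs of positions that agree on the deleted vertices
  and at \<open>\<gamma>\<close> (two codes of the same type), respectively that differ at \<open>\<gamma>\<close> after reversing one of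
  them (codes of different type). In the first case, flipping the path vertex before the first
  disagreement changes the sign of the summand; in the second case exchanging the two positions does.\<close>

section \<open>Correlations as sums over pairs of positions\<close>

text \<open>Covers both signs of the shift at once. The set is empty once
  \<open>\<bar>\<tau>\<bar> \<ge> N\<close>, which absorbs the default 0 of
  \<open>corr\<close>.\<close>

definition shift_pairs :: "nat \<Rightarrow> int \<Rightarrow> (nat \<times> nat) set" where
  "shift_pairs N \<tau> = {(u, w). u < N \<and> w < N \<and> int u = int w + \<tau>}"

definition xcorr ::
  "nat \<Rightarrow> 'x set \<Rightarrow> ('x \<Rightarrow> nat \<Rightarrow> complex) \<Rightarrow> ('x \<Rightarrow> nat \<Rightarrow> complex) \<Rightarrow> int \<Rightarrow> complex" where
  "xcorr N I F G \<tau> = (\<Sum>x\<in>I. \<Sum>(u, w)\<in>shift_pairs N \<tau>. F x u * cnj (G x w))"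

lemma finite_shift_pairs [simp]: "finite (shift_pairs N \<tau>)"
  by (rule finite_subset[of _ "{..<N} \<times> {..<N}"]) (auto simp: shift_pairs_def)

lemma corr_conv_shift_pairs:
  "corr (map f [0..<N]) (map g [0..<N]) \<tau> = (\<Sum>(u, w)\<in>shift_pairs N \<tau>. f u * cnj (g w))"
proof -
  consider "0 \<le> \<tau> \<and> \<tau> < int N" | "- int N < \<tau> \<and> \<tau> < 0" | "\<tau> \<ge> int N \<or> \<tau> \<le> - int N"
    by linarith
  then show ?thesis
  proof cases
    case 1
    have "(\<Sum>i = 0..int N - 1 - \<tau>. map f [0..<N] ! nat (i + \<tau>) * cnj (map g [0..<N] ! nat i))
        = (\<Sum>(u, w)\<in>shift_pairs N \<tau>. f u * cnj (g w))"
      by (rule sum.reindex_bij_witness[where i = "\<lambda>(u, w). int w"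
            and j = "\<lambda>i. (nat (i + \<tau>), nat i)"]) (use 1 in \<open>auto simp: shift_pairs_def\<close>)
    then show ?thesis using 1 by (simp add: corr_def)
  next
    case 2
    have "(\<Sum>i = 0..int N + \<tau> - 1. map f [0..<N] ! nat i * cnj (map g [0..<N] ! nat (i - \<tau>)))
        = (\<Sum>(u, w)\<in>shift_pairs N \<tau>. f u * cnj (g w))"
      by (rule sum.reindex_bij_witness[where i = "\<lambda>(u, w). int u"
            and j = "\<lambda>i. (nat i, nat (i - \<tau>))"]) (use 2 in \<open>auto simp: shift_pairs_def\<close>)
    then show ?thesis using 2 by (simp add: corr_def)
  next
    case 3
    then have "shift_pairs N \<tau> = {}" by (auto simp: shift_pairs_def)
    then show ?thesis using 3 by (auto simp: corr_def Let_def)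
  qed
qed

text \<open>Rows are paired by a common index, so their order drops out and only the set of indices
  remains.\<close>

lemma code_corr_map:
  assumes "distinct ord"
  shows "code_corr (map (\<lambda>x. map (F x) [0..<N]) ord) (map (\<lambda>x. map (G x) [0..<N]) ord) \<tau>
    = xcorr N (set ord) F G \<tau>"
proof -
  have "(\<Sum>\<nu><length ord. h (ord ! \<nu>)) = (\<Sum>x\<in>set ord. h x)" for h :: "'a \<Rightarrow> complex"
    by (rule sum.reindex_bij_betw) (simp add: bij_betw_nth[OF assms])
  then show ?thesis by (simp add: code_corr_def xcorr_def corr_conv_shift_pairs)
qed

lemma xcorr_commute: "xcorr N I G F \<tau> = cnj (xcorr N I F G (- \<tau>))"
proof -
  have "(\<Sum>(u, w)\<in>shift_pairs N \<tau>. G x u * cnj (F x w))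
      = (\<Sum>(u, w)\<in>shift_pairs N (- \<tau>). cnj (F x u * cnj (G x w)))" for x
    by (rule sum.reindex_bij_witness[where i = prod.swap and j = prod.swap])
       (auto simp: shift_pairs_def)
  then show ?thesis by (simp add: xcorr_def cnj_sum case_prod_unfold)
qed

text \<open>With \<open>u = b * L + i\<close> and \<open>w = c * L + i'\<close>, the condition
  \<open>u = w + \<tau>\<close> becomes a shift of \<open>i\<close> against \<open>i'\<close> by
  \<open>\<tau> - (b - c) * L\<close>.\<close>

lemma xcorr_tensor:
  assumes "0 < L"
  shows "xcorr (p * L) I (\<lambda>x u. A x (u mod L) * X (u div L)) (\<lambda>x u. B x (u mod L) * Y (u div L)) \<tau>
    = (\<Sum>(b, c)\<in>{..<p} \<times> {..<p}. X b * cnj (Y c) *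
        xcorr L I A B (\<tau> - (int b - int c) * int L))"
proof -
  let ?D = "\<lambda>(b, c). shift_pairs L (\<tau> - (int b - int c) * int L)"
  let ?Q = "{..<p} \<times> {..<p}"
  have digits: "int u = int (u div L) * int L + int (u mod L)" for u
    by (metis div_mult_mod_eq of_nat_add of_nat_mult)
  have lt: "b * L + i < p * L" if "b < p" "i < L" for b i
  proof -
    have "b * L + i < Suc b * L" using that by simp
    also have "\<dots> \<le> p * L" using that by (intro mult_le_mono1) simp
    finally show ?thesis .
  qed
  have "(\<Sum>(u, w)\<in>shift_pairs (p * L) \<tau>.
          A x (u mod L) * X (u div L) * cnj (B x (w mod L) * Y (w div L)))
      = (\<Sum>((b, c), (i, i'))\<in>Sigma ?Q ?D. X b * cnj (Y c) * (A x i * cnj (B x i')))" for x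
  proof (rule sum.reindex_bij_witness[where
        i = "\<lambda>((b, c), (i, i')). (b * L + i, c * L + i')" and
        j = "\<lambda>(u, w). ((u div L, w div L), (u mod L, w mod L))"], goal_cases)
    case (2 z)
    then show ?case
      using assms digits[of "fst z"] digits[of "snd z"]
      by (auto simp: shift_pairs_def less_mult_imp_div_less algebra_simps)
  next
    case (4 z)
    then show ?case using lt by (auto simp: shift_pairs_def algebra_simps)
  qed (use assms in \<open>auto simp: shift_pairs_def\<close>)
  also have "\<dots>x = (\<Sum>(b, c)\<in>?Q. \<Sum>(i, i')\<in>?D (b, c). X b * cnj (Y c) * (A x i * cnj (B x i')))" for x
    by (simp add: case_prod_unfold sum.Sigma)
  finally have step: "(\<Sum>(u, w)\<in>shift_pairs (p * L) \<tau>.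
          A x (u mod L) * X (u div L) * cnj (B x (w mod L) * Y (w div L)))
      = (\<Sum>(b, c)\<in>?Q. \<Sum>(i, i')\<in>?D (b, c). X b * cnj (Y c) * (A x i * cnj (B x i')))" for x .
  show ?thesis
    unfolding xcorr_def step
    by (subst sum.swap) (auto intro!: sum.cong simp: sum_distrib_left case_prod_unfold)
qed

lemma xcorr_tensor_eq_0:
  assumes "0 < L" "\<And>\<sigma>. xcorr L I A B \<sigma> = 0"
  shows "xcorr (p * L) I (\<lambda>x u. A x (u mod L) * X (u div L)) (\<lambda>x u. B x (u mod L) * Y (u div L)) \<tau> = 0"
  unfolding xcorr_tensor[OF assms(1)] assms(2) by (simp add: case_prod_unfold)

text \<open>Shifts by nonzero multiples of \<open>L\<close> are excluded by \<open>\<bar>\<tau>\<bar> < L\<close>, so only the diagonal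
  blocks survive.\<close>

lemma xcorr_tensor_delta:
  assumes "0 < L" "\<And>\<sigma>. \<sigma> \<noteq> 0 \<Longrightarrow> xcorr L I A B \<sigma> = 0" "\<bar>\<tau>\<bar> < int L"
  shows "xcorr (p * L) I (\<lambda>x u. A x (u mod L) * X (u div L)) (\<lambda>x u. B x (u mod L) * Y (u div L)) \<tau>
    = (if \<tau> = 0 then (\<Sum>b<p. X b * cnj (Y b)) * xcorr L I A B 0 else 0)"
proof -
  have ne: "\<tau> - (int b - int c) * int L = 0 \<longleftrightarrow> \<tau> = 0 \<and> b = c" for b c
  proof
    assume *: "\<tau> - (int b - int c) * int L = 0"
    then have "\<bar>int b - int c\<bar> * int L < 1 * int L"
      using assms(3) by (simp add: abs_mult)
    then have "\<bar>int b - int c\<bar> < 1" by (rule mult_right_less_imp_less) simp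
    then show "\<tau> = 0 \<and> b = c" using * by auto
  qed auto
  have "(\<Sum>(b, c)\<in>{..<p} \<times> {..<p}. X b * cnj (Y c) *
        xcorr L I A B (\<tau> - (int b - int c) * int L))
     = (\<Sum>b<p. \<Sum>c<p. if c = b then if \<tau> = 0 then X b * cnj (Y b) * xcorr L I A B 0 else 0 else 0)"
    unfolding sum.cartesian_product[symmetric]
  proof (intro sum.cong refl)
    fix b c
    show "X b * cnj (Y c) * xcorr L I A B (\<tau> - (int b - int c) * int L) =
      (if c = b then if \<tau> = 0 then X b * cnj (Y b) * xcorr L I A B 0 else 0 else 0)"
      using assms(2)[of "\<tau> - (int b - int c) * int L"] ne[of b c] by auto
  qed
  then show ?thesis
    unfolding xcorr_tensor[OF assms(1)] by (simp add: sum_distrib_right)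
qed


section \<open>Roots of unity, signs and bits\<close>

lemma \<omega>_add: "\<omega> q (a + b) = \<omega> q a * \<omega> q b"
  by (simp add: \<omega>_def exp_add[symmetric] add_divide_distrib distrib_left)

lemma \<omega>_0 [simp]: "\<omega> q 0 = 1"
  by (simp add: \<omega>_def)

lemma cnj_\<omega>: "cnj (\<omega> q a) = \<omega> q (- a)"
  by (simp add: \<omega>_def exp_cnj)

lemma \<omega>_mult_cnj [simp]: "\<omega> q a * cnj (\<omega> q a) = 1"
  by (simp add: cnj_\<omega> \<omega>_add[symmetric])

lemma \<omega>_sum: "finite A \<Longrightarrow> \<omega> q (\<Sum>x\<in>A. f x) = (\<Prod>x\<in>A. \<omega> q (f x))"
  by (induction A rule: finite_induct) (auto simp: \<omega>_add)

lemma \<omega>_of_int_mult: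
  assumes "q > 0"
  shows "\<omega> q (real q * of_int n) = 1"
proof -
  have "\<omega> q (real q * of_int n) = exp (2 * of_int n * of_real pi * \<i>)"
    using assms by (simp add: \<omega>_def field_simps)
  then show ?thesis by (simp add: exp_eq_1) 
qed

text \<open>Removes the reduction modulo \<open>q\<close> in \<open>gbf\<close>, so that the
  exponent splits additively over the monomials.\<close>

lemma \<omega>_mod:
  assumes "q > 0"
  shows "\<omega> q (real (n mod q)) = \<omega> q (real n)"
proof -
  have "real n = real (n mod q) + real q * of_int (int (n div q))"
    by (metis mod_mult_div_eq of_int_of_nat_eq of_nat_add of_nat_mult)
  then show ?thesis by (simp only: \<omega>_add \<omega>_of_int_mult[OF assms] mult_1_right)
qed

lemma \<omega>_half:
  assumes "q > 0"
  shows "\<omega> q (real q / 2) = -1"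
  using assms by (simp add: \<omega>_def)

text \<open>The sign \<open>(-1)^b\<close>. Being real, it passes unchanged through
  conjugation.\<close>

definition sg :: "bool \<Rightarrow> complex" where
  "sg b = (if b then -1 else 1)"

lemma cnj_sg [simp]: "cnj (sg b) = sg b"
  by (simp add: sg_def)

lemma sg_mult_self [simp]: "sg b * sg b = 1"
  by (simp add: sg_def)

lemma \<omega>_half_of_bool:
  assumes "q > 0"
  shows "\<omega> q (real q / 2 * of_bool b) = sg b"
  using \<omega>_half[OF assms] by (simp add: sg_def)

text \<open>For distinct \<open>l\<close> and \<open>l'\<close> the sum is geometric; its ratio
  \<open>z\<close> satisfies \<open>z ^ p = 1\<close> and is not 1.\<close>

lemma sum_\<omega>_orthogonal:
  assumes "q > 0" "l < p" "l' < p"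
  shows "(\<Sum>b<p. \<omega> q (real l * real q / real p * real b) * cnj (\<omega> q (real l' * real q / real p * real b)))
    = (if l = l' then of_nat p else 0)"
proof (cases "l = l'")
  case False
  define \<delta> where "\<delta> = (real l - real l') * real q / real p"
  define z where "z = \<omega> q \<delta>"
  have "\<omega> q (real l * real q / real p * real b) * cnj (\<omega> q (real l' * real q / real p * real b)) = z ^ b" for b
  proof -
    have "\<omega> q (\<delta> * real b) = z ^ b"
      by (induction b) (auto simp: z_def \<omega>_add distrib_left)
    then show ?thesis
      by (simp add: cnj_\<omega> \<omega>_add[symmetric] \<delta>_def diff_divide_distrib left_diff_distrib)
  qed
  then have "(\<Sum>b<p. \<omega> q (real l * real q / real p * real b) * cnj (\<omega> q (real l' * real q / real p * real b)))
     = (\<Sum>b<p. z ^ b)" by simp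
  also have "z ^ p = \<omega> q (\<delta> * real p)"
    by (induction p) (auto simp: z_def \<omega>_add distrib_left)
  then have "z ^ p = 1"
    using \<omega>_of_int_mult[OF assms(1), of "int l - int l'"] assms by (simp add: \<delta>_def mult.commute)
  \<comment> \<open>\<open>z = 1\<close> would make \<open>l - l'\<close> a multiple of
    \<open>p\<close>, although \<open>0 < \<bar>l - l'\<bar> < p\<close>.\<close>
  have "z \<noteq> 1"
  proof
    assume "z = 1"
    then obtain n :: int where "2 * pi * \<delta> / real q = of_int (2 * n) * pi"
      by (auto simp: z_def \<omega>_def exp_eq_1)
    then have "\<delta> = of_int n * real q" using assms by (simp add: field_simps)
    then have "(real l - real l') * real q = (of_int n * real p) * real q"
      using assms by (simp add: \<delta>_def field_simps)
    then have "real l - real l' = of_int n * real p" using assms(1) by (simp only: mult_cancel_right) simp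
    then have "real_of_int (int l - int l') = of_int (n * int p)" by simp
    then have eq: "int l - int l' = n * int p" by (simp only: of_int_eq_iff)
    then have "\<bar>n\<bar> * int p = \<bar>int l - int l'\<bar>" by (simp add: abs_mult)
    then have "\<bar>n\<bar> * int p < 1 * int p" using assms by linarith
    then have "\<bar>n\<bar> < 1" by (rule mult_right_less_imp_less) simp
    then show False using eq False by simp
  qed
  then have "(\<Sum>b<p. z ^ b) = 0"
    using \<open>z ^ p = 1\<close> by (simp add: geometric_sum)
  finally show ?thesis using False by simp
qed simp

text \<open>Reindexing by the involution gives \<open>sum f A = - sum f A\<close>. Fixed points are
  harmless, since \<open>f\<close> vanishes there.\<close>

lemma sum_sign_reversing:
  fixes f :: "'a \<Rightarrow> complex"
  assumes "\<And>x. x \<in> A \<Longrightarrow> h x \<in> A" "\<And>x. x \<in> A \<Longrightarrow> h (h x) = x"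
    "\<And>x. x \<in> A \<Longrightarrow> f (h x) = - f x"
  shows "sum f A = 0"
proof -
  have "sum f A = (\<Sum>x\<in>A. - f x)"
    by (rule sum.reindex_bij_witness[of _ h h]) (use assms in auto)
  then show ?thesis by (simp add: sum_negf)
qed

text \<open>Expanding a product of \<open>k\<close> two-term factors chooses one bit per factor.
  This lets the sum over \<open>ds\<close> factor over the deleted vertices.\<close>

lemma sum_lists_prod:
  fixes h :: "nat \<Rightarrow> bool \<Rightarrow> 'a::comm_semiring_1"
  shows "(\<Sum>ds\<in>{ds. length ds = k}. \<Prod>\<alpha><k. h \<alpha> (ds ! \<alpha>)) = (\<Prod>\<alpha><k. h \<alpha> False + h \<alpha> True)"
proof (induction k arbitrary: h)
  case (Suc k)
  have "(\<Sum>ds\<in>{ds. length ds = Suc k}. \<Prod>\<alpha><Suc k. h \<alpha> (ds ! \<alpha>))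
      = (\<Sum>(b, ds)\<in>UNIV \<times> {ds. length ds = k}. h 0 b * (\<Prod>\<alpha><k. h (Suc \<alpha>) (ds ! \<alpha>)))"
    by (rule sum.reindex_bij_witness[where i = "\<lambda>(b, ds). b # ds" and j = "\<lambda>ds. (hd ds, tl ds)"])
       (auto simp: length_Suc_conv prod.lessThan_Suc_shift simp del: prod.lessThan_Suc)
  also have "\<dots> = (\<Sum>b\<in>UNIV. h 0 b * (\<Prod>\<alpha><k. h (Suc \<alpha>) False + h (Suc \<alpha>) True))"
    by (simp add: sum.cartesian_product[symmetric] sum_distrib_left[symmetric]
        Suc.IH[of "\<lambda>\<alpha>. h (Suc \<alpha>)"])
  finally show ?case
    by (simp add: UNIV_bool prod.lessThan_Suc_shift algebra_simps del: prod.lessThan_Suc)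
qed simp

section \<open>Bits of positions: flips, reversal, high-order part\<close>

lemma less_exp_iff_bits: "(u::nat) < 2 ^ m \<longleftrightarrow> (\<forall>i\<ge>m. \<not> bit u i)"
proof
  assume "u < 2 ^ m"
  then have "take_bit m u = u" by (simp add: take_bit_nat_eq_self)
  then show "\<forall>i\<ge>m. \<not> bit u i" by (metis bit_take_bit_iff leD)
next
  assume "\<forall>i\<ge>m. \<not> bit u i"
  then have "take_bit m u = u" by (intro bit_eqI) (auto simp: bit_take_bit_iff not_le[symmetric])
  then show "u < 2 ^ m" by (simp add: take_bit_nat_eq_self_iff)
qed

lemma bit_flip: "bit (flip_bit n (u::nat)) = (bit u)(n := \<not> bit u n)"
  by (auto simp: fun_eq_iff bit_flip_bit_iff)

lemma bit_flip_eq_iff: "bit (flip_bit n (u::nat)) i = bit (flip_bit n (w::nat)) i \<longleftrightarrow> bit u i = bit w i"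
  by (auto simp: bit_flip)

lemma flip_flip [simp]: "flip_bit n (flip_bit n (u::nat)) = u"
  by (rule bit_eqI) (simp add: bit_flip)

lemma flip_less_exp: "u < 2 ^ m \<Longrightarrow> n < m \<Longrightarrow> flip_bit n (u::nat) < 2 ^ m"
  by (auto simp: less_exp_iff_bits bit_flip)

text \<open>Equal bits change both numbers by the same \<open>2 ^ n\<close> or
  \<open>- (2 ^ n)\<close>, so a common flip preserves the shift between two positions.\<close>

lemma flip_diff:
  assumes "bit u n = bit w n"
  shows "int (flip_bit n u) - int (flip_bit n w) = int u - int w"
proof -
  have *: "int (flip_bit n v) = int v + (if bit v n then - (2 ^ n) else 2 ^ n)" for v :: nat
  proof (cases "bit v n")
    case True
    have "flip_bit n (int v) = int v - 2 ^ n"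
      using True by (simp add: flip_bit_eq_if unset_bit_eq bit_of_nat_iff)
    then show ?thesis using True by (simp add: of_nat_flip_bit_eq)
  next
    case False
    have "flip_bit n (int v) = int v + 2 ^ n"
      using False by (simp add: flip_bit_eq_if set_bit_eq bit_of_nat_iff)
    then show ?thesis using False by (simp add: of_nat_flip_bit_eq)
  qed
  show ?thesis using assms by (simp add: *)
qed

text \<open>Links reversal of positions with negation of the variables. Over \<open>int\<close>, the
  difference from \<open>mask m\<close> is the truncated bitwise complement.\<close>

lemma bit_complement:
  assumes "u < 2 ^ m" "i < m"
  shows "bit (2 ^ m - 1 - u :: nat) i \<longleftrightarrow> \<not> bit u i"
proof -
  have "int (2 ^ m - 1 - u) = 2 ^ m - 1 - int u" using assms by (simp add: of_nat_diff)
  also have "\<dots> = mask m - take_bit m (int u)"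
    using assms by (simp add: mask_eq_exp_minus_1 take_bit_int_eq_self)
  also have "\<dots> = take_bit m (not (int u))" by (rule take_bit_not_eq_mask_diff[symmetric])
  finally have "bit (int (2 ^ m - 1 - u)) i = bit (take_bit m (not (int u))) i" by simp
  then have "bit (2 ^ m - 1 - u) i = bit (take_bit m (not (int u))) i"
    by (simp only: bit_of_nat_iff_bit)
  then show ?thesis using assms by (simp add: bit_take_bit_iff bit_not_iff bit_of_nat_iff_bit)
qed

text \<open>The linear form in the last \<open>s\<close> variables is the number of the block of
  length \<open>2 ^ m\<close> containing \<open>r\<close>; this is the source of the tensor
  structure.\<close>

lemma sum_bits_div:
  assumes "r < 2 ^ (m + s)"
  shows "(\<Sum>i<s. 2 ^ i * of_bool (bit r (m + i)) :: real) = real (r div 2 ^ m)"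
proof -
  have "r div 2 ^ m < 2 ^ s"
    using assms by (simp add: less_mult_imp_div_less power_add mult.commute)
  then have "r div 2 ^ m = take_bit s (r div 2 ^ m)" by (simp add: take_bit_nat_eq_self)
  also have "\<dots> = (\<Sum>i<s. 2 ^ i * of_bool (bit r (m + i)))"
    by (simp add: take_bit_sum push_bit_eq_mult drop_bit_eq_div[symmetric] bit_drop_bit_eq
        lessThan_atLeast0 mult.commute)
  finally have "real (r div 2 ^ m) = real (\<Sum>i<s. 2 ^ i * of_bool (bit r (m + i)))" by simp
  then show ?thesis by simp
qed


section \<open>Generalized Boolean functions along a path\<close>

lemma gbf_cong: "(\<And>i. i < m \<Longrightarrow> x i = y i) \<Longrightarrow> gbf q m a x = gbf q m a y"
  unfolding gbf_def by (intro arg_cong2[of _ _ _ _ "(mod)"] sum.cong prod.cong arg_cong2[of _ _ _ _ "(*)"]) auto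

text \<open>In terms of exponents: only the monomial \<open>x\<^sub>n x\<^sub>z\<close> sees the flip of \<open>x\<^sub>n\<close> differently for
  \<open>x\<close> and \<open>y\<close>, so \<open>f(x) - f(y)\<close> changes by \<open>q/2\<close>.\<close>

lemma gbf_flip:
  assumes q: "even q" "q > 0" and nz: "n < m" "z < m" "n \<noteq> z" "a {n, z} = q div 2"
    and xy: "x n = y n" "x z \<noteq> y z"
    and other: "\<And>S i. S \<subseteq> {..<m} \<Longrightarrow> n \<in> S \<Longrightarrow> a S \<noteq> 0 \<Longrightarrow> S \<noteq> {n, z} \<Longrightarrow> i \<in> S \<Longrightarrow> x i = y i"
  shows "\<omega> q (real (gbf q m a (x(n := \<not> x n)))) * cnj (\<omega> q (real (gbf q m a (y(n := \<not> y n)))))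
    = - (\<omega> q (real (gbf q m a x)) * cnj (\<omega> q (real (gbf q m a y))))"
proof -
  define T where "T v S = real (a S * (\<Prod>i\<in>S. of_bool (v i)))" for v :: "nat \<Rightarrow> bool" and S
  \<comment> \<open>Three kinds of monomials: those without \<open>n\<close> ignore the flip, those
    in \<open>P1\<close> take equal values at both arguments and cancel against the conjugate, and
    \<open>{n, z}\<close> alone produces a sign.\<close>
  define P0 where "P0 = {S \<in> Pow {..<m}. n \<notin> S}"
  define P1 where "P1 = {S \<in> Pow {..<m}. n \<in> S \<and> S \<noteq> {n, z}}"
  define E where "E v = \<omega> q (\<Sum>S\<in>P0. T v S)" for v
  define H where "H v = \<omega> q (\<Sum>S\<in>P1. T v S)" for v
  have split: "\<omega> q (real (gbf q m a v)) = E v * H v * sg (v n \<and> v z)" for v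
  proof -
    have fin: "finite P0" "finite P1" by (auto simp: P0_def P1_def)
    have Pow: "Pow {..<m} = insert {n, z} (P0 \<union> P1)"
      using nz by (auto simp: P0_def P1_def)
    have "(\<Sum>S\<in>Pow {..<m}. T v S) = T v {n, z} + ((\<Sum>S\<in>P0. T v S) + (\<Sum>S\<in>P1. T v S))"
      unfolding Pow using fin
      by (subst sum.insert) (auto simp: P0_def P1_def intro!: sum.union_disjoint)
    moreover have "T v {n, z} = real q / 2 * of_bool (v n \<and> v z)"
      using nz q by (auto simp: T_def real_of_nat_div)
    moreover have "\<omega> q (real (gbf q m a v)) = \<omega> q (\<Sum>S\<in>Pow {..<m}. T v S)"
      unfolding gbf_def \<omega>_mod[OF q(2)] by (simp add: T_def)
    ultimately show ?thesis
      by (simp only: \<omega>_add \<omega>_half_of_bool[OF q(2)] E_def H_def mult_ac)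
  qed
  let ?x = "x(n := \<not> x n)" and ?y = "y(n := \<not> y n)"
  have E: "E (v(n := b)) = E v" for v b
    unfolding E_def T_def
    by (intro arg_cong[of _ _ "\<omega> q"] sum.cong refl arg_cong[of _ _ real] arg_cong2[of _ _ _ _ "(*)"] prod.cong)
       (auto simp: P0_def)
  have HT: "T x S = T y S \<and> T ?x S = T ?y S" if "S \<in> P1" for S
  proof (cases "a S = 0")
    case False
    then have "\<forall>i\<in>S. x i = y i" using that other[of S] by (auto simp: P1_def)
    then have "\<forall>i\<in>S. x i = y i \<and> ?x i = ?y i" using xy by auto
    then have "(\<Prod>i\<in>S. of_bool (x i)) = (\<Prod>i\<in>S. of_bool (y i) :: nat)"
      "(\<Prod>i\<in>S. of_bool (?x i)) = (\<Prod>i\<in>S. of_bool (?y i) :: nat)"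
      by (intro prod.cong; simp)+
    then show ?thesis by (simp only: T_def)
  qed (simp add: T_def)
  then have H: "H x = H y" "H ?x = H ?y" by (simp_all add: H_def)
  have HH: "H v * cnj (H v) = 1" for v by (simp add: H_def)
  \<comment> \<open>Exactly one of \<open>x z\<close> and \<open>y z\<close> holds, so flipping
    \<open>n\<close> changes exactly one of the two signs.\<close>
  have sgn: "sg (\<not> x n \<and> x z) * sg (\<not> y n \<and> y z) = - (sg (x n \<and> x z) * sg (y n \<and> y z))"
    using xy by (auto simp: sg_def)
  have cancel: "E x * H v * r * cnj (E y * H v * r') = E x * cnj (E y) * (r * cnj r')" for v r r'
  proof -
    have "E x * H v * r * cnj (E y * H v * r') = E x * cnj (E y) * (r * cnj r') * (H v * cnj (H v))"
      by (simp add: mult_ac)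
    then show ?thesis by (simp add: HH)
  qed
  have flip: "?x n = (\<not> x n)" "?x z = x z" "?y n = (\<not> y n)" "?y z = y z" using nz(3) by auto
  show ?thesis unfolding split E H flip cancel cnj_sg sgn by (rule mult_minus_right)
qed

text \<open>The graph hypotheses in the form the sign argument uses, with the path read from
  \<open>\<gamma>\<close>. By \<open>no_edge\<close>, apart from the edge to its successor, a path
  vertex that has a successor occurs only in monomials made of deleted vertices, itself and earlier
  path vertices.\<close>

locale path_code =
  fixes q m k \<gamma> :: nat and a :: "nat set \<Rightarrow> nat" and j :: "nat \<Rightarrow> nat" and vs :: "nat list"
  assumes even_q: "even q" and q_pos: "q > 0"
    and inj_j: "inj_on j {..<k}" and j_less: "\<And>\<alpha>. \<alpha> < k \<Longrightarrow> j \<alpha> < m"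
    and vs: "vs \<noteq> []" "distinct vs" "set vs = {..<m} - j ` {..<k}" and \<gamma>: "\<gamma> = hd vs"
    and edge: "\<And>i. Suc i < length vs \<Longrightarrow> a {vs ! i, vs ! Suc i} = q div 2"
    and no_edge: "\<And>i S l. \<lbrakk>Suc i < length vs; S \<subseteq> {..<m}; vs ! i \<in> S; a S \<noteq> 0;
      S \<noteq> {vs ! i, vs ! Suc i}; l \<in> S\<rbrakk> \<Longrightarrow> l \<in> j ` {..<k} \<union> set (take (Suc i) vs)"
begin

lemma \<gamma>_less: "\<gamma> < m"
  using vs \<gamma> hd_in_set[of vs] by auto

section \<open>The tensor factors of length \<open>2 ^ m\<close>\<close>

definition \<phi> :: "nat \<Rightarrow> complex" where
  "\<phi> u = \<omega> q (real (gbf q m a (bit u)))"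

definition D :: "nat \<Rightarrow> bool list \<Rightarrow> nat \<Rightarrow> complex" where
  "D t ds u = (\<Prod>\<alpha><k. sg (ds ! \<alpha> \<and> bit u (j \<alpha>)) * sg (bit t \<alpha> \<and> bit u (j \<alpha>)))"

definition A :: "nat \<Rightarrow> bool list \<times> bool \<Rightarrow> nat \<Rightarrow> complex" where
  "A t = (\<lambda>(ds, d) u. \<phi> u * D t ds u * sg (d \<and> bit u \<gamma>))"

text \<open>Complementing all bits of a position below \<open>2\<^sup>m\<close> is the reversal \<open>u \<mapsto> 2\<^sup>m - 1 - u\<close>, which turns
  the sequences of \<open>V\<close> into those of \<open>U\<close> up to sign.\<close>

definition B :: "nat \<Rightarrow> bool list \<times> bool \<Rightarrow> nat \<Rightarrow> complex" where
  "B t = (\<lambda>(ds, d) u. sg (\<not> d) * A t (ds, \<not> d) (2 ^ m - 1 - u))"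

definition idx :: "(bool list \<times> bool) set" where
  "idx = {ds. length ds = k} \<times> UNIV"

text \<open>A character in the bits of \<open>u\<close> at the deleted vertices, with frequency
  \<open>t XOR t'\<close>.\<close>

definition twist :: "nat \<Rightarrow> nat \<Rightarrow> nat \<Rightarrow> complex" where
  "twist t t' u = (\<Prod>\<alpha><k. sg (bit t \<alpha> \<and> bit u (j \<alpha>)) * sg (bit t' \<alpha> \<and> bit u (j \<alpha>)))"

definition agree :: "nat \<Rightarrow> nat \<Rightarrow> bool" where
  "agree u w \<longleftrightarrow> (\<forall>\<alpha><k. bit u (j \<alpha>) = bit w (j \<alpha>))"

section \<open>Summation over the code index\<close>

lemma sum_idx: "(\<Sum>x\<in>idx. h x) = (\<Sum>ds\<in>{ds. length ds = k}. \<Sum>d\<in>UNIV. h (ds, d))"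
  unfolding idx_def by (rule sum.cartesian_product')

lemma cnj_D [simp]: "cnj (D t ds u) = D t ds u"
  by (simp add: D_def)

lemma \<phi>_mult_cnj [simp]: "\<phi> u * cnj (\<phi> u) = 1"
  by (simp add: \<phi>_def)

text \<open>The sum factors over the deleted vertices. The two terms for one vertex cancel if
  \<open>u\<close> and \<open>w\<close> differ there and are equal otherwise.\<close>

lemma sum_D:
  "(\<Sum>ds\<in>{ds. length ds = k}. D t ds u * D t' ds w) = (if agree u w then 2 ^ k * twist t t' u else 0)"
proof -
  let ?h = "\<lambda>\<alpha> b. sg (b \<and> bit u (j \<alpha>)) * sg (bit t \<alpha> \<and> bit u (j \<alpha>)) *
    (sg (b \<and> bit w (j \<alpha>)) * sg (bit t' \<alpha> \<and> bit w (j \<alpha>)))"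
  have "(\<Sum>ds\<in>{ds. length ds = k}. D t ds u * D t' ds w) = (\<Prod>\<alpha><k. ?h \<alpha> False + ?h \<alpha> True)"
    unfolding sum_lists_prod[of ?h k, symmetric] by (simp add: D_def prod.distrib)
  also have "\<dots> = (if agree u w then 2 ^ k * twist t t' u else 0)"
  proof (cases "agree u w")
    case True
    then have "(\<Prod>\<alpha><k. ?h \<alpha> False + ?h \<alpha> True)
       = (\<Prod>\<alpha><k. 2 * (sg (bit t \<alpha> \<and> bit u (j \<alpha>)) * sg (bit t' \<alpha> \<and> bit u (j \<alpha>))))"
      by (intro prod.cong) (auto simp: agree_def sg_def)
    then show ?thesis using True by (simp add: twist_def prod.distrib)
  next
    case False
    then obtain \<alpha> where "\<alpha> < k" "bit u (j \<alpha>) \<noteq> bit w (j \<alpha>)" by (auto simp: agree_def)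
    then have "\<exists>\<alpha>\<in>{..<k}. ?h \<alpha> False + ?h \<alpha> True = 0"
      by (intro bexI[of _ \<alpha>]) (auto simp: sg_def)
    then show ?thesis using False by (simp add: prod_zero_iff)
  qed
  finally show ?thesis .
qed

text \<open>The bits \<open>ds\<close> detect agreement on the deleted vertices, and
  \<open>d\<close> detects agreement at \<open>\<gamma>\<close>.\<close>

lemma sum_A:
  "(\<Sum>x\<in>idx. A t x u * cnj (A t' x w)) =
    (if agree u w \<and> bit u \<gamma> = bit w \<gamma> then 2 ^ (k + 1) * (\<phi> u * cnj (\<phi> w) * twist t t' u) else 0)"
proof -
  have "(\<Sum>x\<in>idx. A t x u * cnj (A t' x w)) =
     (\<Sum>ds\<in>{ds. length ds = k}. D t ds u * D t' ds w *
        (\<phi> u * cnj (\<phi> w) * (\<Sum>d\<in>UNIV. sg (d \<and> bit u \<gamma>) * sg (d \<and> bit w \<gamma>))))"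
    by (simp add: sum_idx A_def sum_distrib_left mult_ac)
  also have "(\<Sum>d\<in>UNIV. sg (d \<and> bit u \<gamma>) * sg (d \<and> bit w \<gamma>)) = (if bit u \<gamma> = bit w \<gamma> then 2 else 0)"
    by (auto simp: UNIV_bool sg_def)
  finally show ?thesis by (simp add: sum_distrib_right[symmetric] sum_D)
qed

text \<open>The extra factor \<open>sg (\<not> d)\<close> in \<open>B\<close> turns the sum over
  \<open>d\<close> into \<open>sg (bit u \<gamma>) - sg (bit v \<gamma>)\<close>, which detects
  disagreement at \<open>\<gamma>\<close> instead.\<close>

lemma sum_A_B:
  fixes w :: nat
  defines "v \<equiv> 2 ^ m - 1 - w"
  shows "(\<Sum>x\<in>idx. A t x u * B t' x w) =
    (if agree u v \<and> bit u \<gamma> \<noteq> bit v \<gamma> then 2 ^ (k + 1) * (\<phi> u * \<phi> v * twist t t' u * sg (bit u \<gamma>)) else 0)"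
proof -
  have B: "B t' (ds, d) w = sg (\<not> d) * (\<phi> v * D t' ds v * sg (\<not> d \<and> bit v \<gamma>))" for ds d
    by (simp add: A_def B_def v_def)
  have "(\<Sum>x\<in>idx. A t x u * B t' x w) =
     (\<Sum>ds\<in>{ds. length ds = k}. D t ds u * D t' ds v *
        (\<phi> u * \<phi> v * (\<Sum>d\<in>UNIV. sg (d \<and> bit u \<gamma>) * sg (\<not> d \<and> bit v \<gamma>) * sg (\<not> d))))"
    by (simp add: sum_idx B A_def sum_distrib_left mult_ac)
  also have "(\<Sum>d\<in>UNIV. sg (d \<and> bit u \<gamma>) * sg (\<not> d \<and> bit v \<gamma>) * sg (\<not> d))
     = (if bit u \<gamma> \<noteq> bit v \<gamma> then 2 * sg (bit u \<gamma>) else 0)"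
    by (auto simp: UNIV_bool sg_def)
  finally show ?thesis by (simp add: sum_distrib_right[symmetric] sum_D)
qed

lemma twist_flip:
  assumes "n \<notin> j ` {..<k}"
  shows "twist t t' (flip_bit n u) = twist t t' u"
  unfolding twist_def using assms by (intro prod.cong) (auto simp: bit_flip)

lemma agree_commute: "agree u w \<longleftrightarrow> agree w u"
  unfolding agree_def by (intro all_cong1 imp_cong refl) (rule eq_commute)

lemma twist_agree: "agree u w \<Longrightarrow> twist t t' w = twist t t' u"
  unfolding twist_def by (intro prod.cong) (auto simp: agree_def)

text \<open>If \<open>t\<close> and \<open>t'\<close> differ at bit \<open>\<beta>\<close>, flipping
  the bit \<open>j \<beta>\<close> of \<open>u\<close> negates the factor of \<open>\<beta>\<close>;
  injectivity of \<open>j\<close> keeps all other factors fixed.\<close>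

lemma sum_twist:
  assumes "t < 2 ^ k" "t' < 2 ^ k"
  shows "(\<Sum>u<2 ^ m. twist t t' u) = (if t = t' then 2 ^ m else 0)"
proof (cases "t = t'")
  case False
  then obtain \<beta> where \<beta>: "bit t \<beta> \<noteq> bit t' \<beta>" by (metis bit_eqI)
  then have "\<beta> < k" using assms by (metis less_exp_iff_bits not_less)
  have "twist t t' (flip_bit (j \<beta>) u) = - twist t t' u" for u
  proof -
    let ?h = "\<lambda>u \<alpha>. sg (bit t \<alpha> \<and> bit u (j \<alpha>)) * sg (bit t' \<alpha> \<and> bit u (j \<alpha>))"
    have rm: "twist t t' v = ?h v \<beta> * (\<Prod>\<alpha>\<in>{..<k} - {\<beta>}. ?h v \<alpha>)" for v
      unfolding twist_def using \<open>\<beta> < k\<close> by (intro prod.remove) auto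
    have "(\<Prod>\<alpha>\<in>{..<k} - {\<beta>}. ?h (flip_bit (j \<beta>) u) \<alpha>) = (\<Prod>\<alpha>\<in>{..<k} - {\<beta>}. ?h u \<alpha>)"
      using inj_j \<open>\<beta> < k\<close> by (intro prod.cong refl) (auto simp: bit_flip inj_on_def)
    moreover have "?h (flip_bit (j \<beta>) u) \<beta> = - ?h u \<beta>"
      using \<beta> by (auto simp: bit_flip sg_def)
    ultimately show ?thesis by (simp only: rm mult_minus_left)
  qed
  then have "(\<Sum>u<2 ^ m. twist t t' u) = 0"
    by (intro sum_sign_reversing[where h = "flip_bit (j \<beta>)"])
       (auto simp: flip_less_exp j_less \<open>\<beta> < k\<close>)
  then show ?thesis using False by simp
qed (simp add: twist_def)

section \<open>Pairing positions at the first disagreement along the path\<close>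

definition first_diff :: "nat \<Rightarrow> nat \<Rightarrow> nat" where
  "first_diff u w = (LEAST i. bit u (vs ! i) \<noteq> bit w (vs ! i))"

text \<open>Distinct positions that agree on the deleted vertices differ somewhere on the path.
  Index 0 is \<open>\<gamma>\<close>, where they agree, so the first disagreement has a
  predecessor.\<close>

lemma first_diff_Suc:
  assumes "u < 2 ^ m" "w < 2 ^ m" "u \<noteq> w" "agree u w" "bit u \<gamma> = bit w \<gamma>"
  obtains i where "first_diff u w = Suc i" "Suc i < length vs"
    "bit u (vs ! Suc i) \<noteq> bit w (vs ! Suc i)" "\<And>l. l \<le> i \<Longrightarrow> bit u (vs ! l) = bit w (vs ! l)"
proof -
  let ?P = "\<lambda>i. bit u (vs ! i) \<noteq> bit w (vs ! i)"
  obtain v where v: "bit u v \<noteq> bit w v" using assms(3) by (metis bit_eqI)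
  then have "v < m" using assms(1,2) by (metis less_exp_iff_bits not_less)
  then have "v \<in> set vs" using v assms(4) vs(3) by (auto simp: agree_def)
  then obtain l where l: "l < length vs" "?P l" using v by (metis in_set_conv_nth)
  let ?r = "first_diff u w"
  have r: "?P ?r" "?r \<le> l" unfolding first_diff_def
    by (rule LeastI[of ?P, OF l(2)], rule Least_le[of ?P, OF l(2)])
  have least: "\<not> ?P i" if "i < ?r" for i using that unfolding first_diff_def by (rule not_less_Least)
  have "?r \<noteq> 0" using r(1) assms(5) \<gamma> vs(1) by (metis hd_conv_nth)
  then obtain i where "?r = Suc i" by (metis not0_implies_Suc)
  then show thesis using that[of i] r least l(1) by auto
qed

text \<open>A common flip preserves the set of differing bits, so flipping twice selects the same
  vertex and is an involution.\<close>

lemma first_diff_flip: "first_diff (flip_bit n u) (flip_bit n w) = first_diff u w"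
  unfolding first_diff_def by (simp only: bit_flip_eq_iff)

lemma agree_flip: "agree (flip_bit n u) (flip_bit n w) \<longleftrightarrow> agree u w"
  unfolding agree_def by (simp only: bit_flip_eq_iff)

text \<open>The involution flips, in both positions, the bit of the path vertex just before the first
  vertex at which they differ.\<close>

lemma sum_agree_0:
  assumes "\<sigma> \<noteq> 0"
  shows "(\<Sum>(u, w)\<in>{(u, w) \<in> shift_pairs (2 ^ m) \<sigma>. agree u w \<and> bit u \<gamma> = bit w \<gamma>}.
    \<phi> u * cnj (\<phi> w) * twist t t' u) = 0"
proof -
  let ?P = "{(u, w) \<in> shift_pairs (2 ^ m) \<sigma>. agree u w \<and> bit u \<gamma> = bit w \<gamma>}"
  let ?n = "\<lambda>u w. vs ! (first_diff u w - 1)"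
  let ?g = "\<lambda>(u, w). (flip_bit (?n u w) u, flip_bit (?n u w) w)"
  let ?F = "\<lambda>(u, w). \<phi> u * cnj (\<phi> w) * twist t t' u"
  have main: "?g z \<in> ?P \<and> ?g (?g z) = z \<and> ?F (?g z) = - ?F z" if P: "z \<in> ?P" for z
  proof -
    obtain u w where z_eq: "z = (u, w)" by fastforce
    have uw: "u < 2 ^ m" "w < 2 ^ m" "int u = int w + \<sigma>" "agree u w" "bit u \<gamma> = bit w \<gamma>"
      using P by (auto simp: shift_pairs_def z_eq)
    have "u \<noteq> w" using uw assms by auto
    obtain i where i: "first_diff u w = Suc i" "Suc i < length vs"
      "bit u (vs ! Suc i) \<noteq> bit w (vs ! Suc i)" "\<And>l. l \<le> i \<Longrightarrow> bit u (vs ! l) = bit w (vs ! l)"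
      using first_diff_Suc[OF uw(1,2) \<open>u \<noteq> w\<close> uw(4,5)] by blast
    define n l where "n = vs ! i" and "l = vs ! Suc i"
    have n: "n < m" "n \<notin> j ` {..<k}" and l: "l < m"
      using vs(3) i(2) nth_mem[of i vs] nth_mem[of "Suc i" vs] by (auto simp: n_def l_def)
    have "n \<noteq> l" using i(2) vs(2) by (simp add: n_def l_def nth_eq_iff_index_eq)
    have eq_n: "bit u n = bit w n" using i(4) by (simp add: n_def)
    have "\<phi> (flip_bit n u) * cnj (\<phi> (flip_bit n w)) = - (\<phi> u * cnj (\<phi> w))"
      unfolding \<phi>_def bit_flip
    proof (rule gbf_flip[OF even_q q_pos n(1) l \<open>n \<noteq> l\<close>])
      fix S v
      assume "S \<subseteq> {..<m}" "n \<in> S" "a S \<noteq> 0" "S \<noteq> {n, l}" "v \<in> S"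
      \<comment> \<open>Every other monomial through \<open>n\<close> involves only deleted vertices
        and path vertices up to \<open>n\<close>, and \<open>u\<close> and \<open>w\<close> agree on
        all of these.\<close>
      then have "v \<in> j ` {..<k} \<union> set (take (Suc i) vs)"
        using no_edge[of i S v] i(2) by (simp add: n_def l_def)
      then show "bit u v = bit w v"
        using uw(4) i(2,4) by (auto simp: agree_def in_set_conv_nth)
    qed (use i edge[of i] eq_n in \<open>auto simp: n_def l_def\<close>)
    then have "\<phi> (flip_bit n u) * cnj (\<phi> (flip_bit n w)) * twist t t' (flip_bit n u)
       = - (\<phi> u * cnj (\<phi> w) * twist t t' u)"
      by (simp add: twist_flip n(2))
    moreover have "(flip_bit n u, flip_bit n w) \<in> ?P"
      using uw flip_diff[OF eq_n] by (auto simp: shift_pairs_def flip_less_exp n(1) agree_flip bit_flip)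
    moreover have "?n (flip_bit n u) (flip_bit n w) = n" "?n u w = n"
      by (simp_all add: first_diff_flip i(1) n_def)
    ultimately show ?thesis unfolding z_eq prod.case by simp
  qed
  show ?thesis
  proof (rule sum_sign_reversing[of ?P ?g ?F])
    fix z assume "z \<in> ?P"
    then show "?g z \<in> ?P" "?g (?g z) = z" "?F (?g z) = - ?F z"
      by (rule main[THEN conjunct1], rule main[THEN conjunct2, THEN conjunct1],
          rule main[THEN conjunct2, THEN conjunct2])
  qed
qed

text \<open>A zero shift leaves only \<open>u = w\<close>, where \<open>\<phi>\<close> cancels
  against its conjugate and \<open>sum_twist\<close> applies; other shifts are killed by
  \<open>sum_agree_0\<close>.\<close>

lemma xcorr_A:
  assumes "t < 2 ^ k" "t' < 2 ^ k"
  shows "xcorr (2 ^ m) idx (A t) (A t') \<sigma> = (if \<sigma> = 0 \<and> t = t' then 2 ^ (k + 1) * 2 ^ m else 0)"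
proof -
  let ?P = "{(u, w) \<in> shift_pairs (2 ^ m) \<sigma>. agree u w \<and> bit u \<gamma> = bit w \<gamma>}"
  have "xcorr (2 ^ m) idx (A t) (A t') \<sigma>
      = (\<Sum>(u, w)\<in>shift_pairs (2 ^ m) \<sigma>. \<Sum>x\<in>idx. A t x u * cnj (A t' x w))"
    unfolding xcorr_def by (subst sum.swap) (simp add: case_prod_unfold)
  also have "\<dots> = (\<Sum>z\<in>shift_pairs (2 ^ m) \<sigma>. if (case z of (u, w) \<Rightarrow> agree u w \<and> bit u \<gamma> = bit w \<gamma>)
      then 2 ^ (k + 1) * (case z of (u, w) \<Rightarrow> \<phi> u * cnj (\<phi> w) * twist t t' u) else 0)"
    unfolding sum_A by (intro sum.cong) (auto simp: case_prod_unfold)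
  also have "\<dots> = 2 ^ (k + 1) * (\<Sum>(u, w)\<in>?P. \<phi> u * cnj (\<phi> w) * twist t t' u)"
    by (subst sum.inter_filter[symmetric]) (auto simp: sum_distrib_left case_prod_unfold)
  finally have *: "xcorr (2 ^ m) idx (A t) (A t') \<sigma> =
    2 ^ (k + 1) * (\<Sum>(u, w)\<in>?P. \<phi> u * cnj (\<phi> w) * twist t t' u)" .
  show ?thesis
  proof (cases "\<sigma> = 0")
    case True
    then have "(\<Sum>(u, w)\<in>?P. \<phi> u * cnj (\<phi> w) * twist t t' u) = (\<Sum>u<2 ^ m. twist t t' u)"
      by (intro sum.reindex_bij_witness[where i = "\<lambda>u. (u, u)" and j = fst])
         (auto simp: shift_pairs_def agree_def)
    then show ?thesis using True * by (simp add: sum_twist[OF assms])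
  next
    case False
    then show ?thesis using * by (simp add: sum_agree_0)
  qed
qed

text \<open>Reversing both positions negates the shift, and conjugation exchanges the two factors,
  which restores it. The signs \<open>sg (\<not> d)\<close> occur twice and cancel.\<close>

lemma xcorr_cnj_B:
  "xcorr (2 ^ m) idx (\<lambda>x u. cnj (B t x u)) (\<lambda>x u. cnj (B t' x u)) \<sigma> = xcorr (2 ^ m) idx (A t') (A t) \<sigma>"
proof -
  let ?c = "\<lambda>x. case x of (ds, d) \<Rightarrow> (ds, \<not> d)" and ?r = "\<lambda>u. 2 ^ m - 1 - u :: nat"
  have B: "cnj (B t x u) * cnj (cnj (B t' x w)) = A t' (?c x) (?r w) * cnj (A t (?c x) (?r u))" for x u w
  proof (cases x)
    case (Pair ds d)
    then show ?thesis by (cases d) (simp_all add: B_def sg_def)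
  qed
  have rev: "(\<Sum>(u, w)\<in>shift_pairs (2 ^ m) \<sigma>. h (?r w) (?r u)) = (\<Sum>(u, w)\<in>shift_pairs (2 ^ m) \<sigma>. h u w)"
    for h :: "nat \<Rightarrow> nat \<Rightarrow> complex"
    by (rule sum.reindex_bij_witness[where i = "\<lambda>(u, w). (?r w, ?r u)" and j = "\<lambda>(u, w). (?r w, ?r u)"])
       (auto simp: shift_pairs_def of_nat_diff)
  have "xcorr (2 ^ m) idx (\<lambda>x u. cnj (B t x u)) (\<lambda>x u. cnj (B t' x u)) \<sigma>
      = (\<Sum>x\<in>idx. \<Sum>(u, w)\<in>shift_pairs (2 ^ m) \<sigma>. A t' (?c x) u * cnj (A t (?c x) w))"
    unfolding xcorr_def B by (intro sum.cong refl rev)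
  also have "\<dots> = xcorr (2 ^ m) idx (A t') (A t) \<sigma>"
    unfolding xcorr_def
    by (rule sum.reindex_bij_witness[where i = ?c and j = ?c]) (auto simp: idx_def)
  finally show ?thesis .
qed

text \<open>After reversal the sum runs over pairs \<open>(u, v)\<close> with \<open>u + v\<close> constant that agree on the deleted
  vertices and differ at \<open>\<gamma>\<close>; exchanging \<open>u\<close> and \<open>v\<close> only changes the sign of the summand.\<close>

lemma xcorr_A_cnj_B: "xcorr (2 ^ m) idx (A t) (\<lambda>x u. cnj (B t' x u)) \<sigma> = 0"
proof -
  let ?r = "\<lambda>u. 2 ^ m - 1 - u :: nat"
  define g where "g u v = (if agree u v \<and> bit u \<gamma> \<noteq> bit v \<gamma>
      then 2 ^ (k + 1) * (\<phi> u * \<phi> v * twist t t' u * sg (bit u \<gamma>)) else 0)" for u v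
  \<comment> \<open>The product of \<open>\<phi>\<close> values is symmetric and
    \<open>twist\<close> is unchanged by agreement, so only the sign at \<open>\<gamma>\<close>
    changes.\<close>
  have anti: "g v u = - g u v" for u v
  proof (cases "agree u v \<and> bit u \<gamma> \<noteq> bit v \<gamma>")
    case True
    then have vu: "agree v u \<and> bit v \<gamma> \<noteq> bit u \<gamma>" using agree_commute by blast
    have tw: "twist t t' v = twist t t' u" by (rule twist_agree) (use True in blast)
    have sgn: "sg (bit v \<gamma>) = - sg (bit u \<gamma>)" using True by (cases "bit u \<gamma>") (simp_all add: sg_def)
    show ?thesis unfolding g_def if_P[OF True] if_P[OF vu] tw sgn by (simp add: mult_ac)
  next
    case False
    then have vu: "\<not> (agree v u \<and> bit v \<gamma> \<noteq> bit u \<gamma>)" using agree_commute by blast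
    show ?thesis unfolding g_def if_not_P[OF False] if_not_P[OF vu] by simp
  qed
  have "xcorr (2 ^ m) idx (A t) (\<lambda>x u. cnj (B t' x u)) \<sigma>
      = (\<Sum>(u, w)\<in>shift_pairs (2 ^ m) \<sigma>. \<Sum>x\<in>idx. A t x u * B t' x w)"
    unfolding xcorr_def by (subst sum.swap) (simp add: case_prod_unfold)
  also have "\<dots> = (\<Sum>(u, w)\<in>shift_pairs (2 ^ m) \<sigma>. g u (?r w))"
    unfolding sum_A_B g_def ..
  also have "\<dots> = 0"
  \<comment> \<open>With \<open>v = ?r w\<close>, this map exchanges \<open>u\<close> and
    \<open>v\<close>, and it preserves the shift.\<close>
  proof (rule sum_sign_reversing[where h = "\<lambda>(u, w). (?r w, ?r u)"], goal_cases)
    case (3 z)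
    obtain u w where z: "z = (u, w)" by fastforce
    have "?r (?r u) = u" using 3 by (auto simp: z shift_pairs_def)
    then show ?case unfolding z prod.case by (simp only: anti[of u "?r w"] minus_minus)
  qed (auto simp: shift_pairs_def of_nat_diff)
  finally show ?thesis .
qed


section \<open>The code family\<close>

definition X :: "nat \<Rightarrow> nat \<Rightarrow> nat \<Rightarrow> complex" where
  "X p l b = \<omega> q (real l * real q / real p * real b)"

text \<open>Stated for arbitrary bits so that it serves both \<open>U_set\<close> and
  \<open>V_set\<close>, where the deleted variables are negated.\<close>

lemma \<omega>_dot:
  "\<omega> q (real q / 2 * ((\<Sum>\<alpha><k. (of_bool (b \<alpha>) + of_bool (b' \<alpha>)) * of_bool (c \<alpha>))
      + of_bool d * of_bool e))
   = (\<Prod>\<alpha><k. sg (b \<alpha> \<and> c \<alpha>) * sg (b' \<alpha> \<and> c \<alpha>)) * sg (d \<and> e)"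
proof -
  have "real q / 2 * ((\<Sum>\<alpha><k. (of_bool (b \<alpha>) + of_bool (b' \<alpha>)) * of_bool (c \<alpha>))
      + of_bool d * of_bool e)
    = (\<Sum>\<alpha><k. real q / 2 * of_bool (b \<alpha> \<and> c \<alpha>) + real q / 2 * of_bool (b' \<alpha> \<and> c \<alpha>))
      + real q / 2 * of_bool (d \<and> e)"
    unfolding distrib_left sum_distrib_left by (simp add: of_bool_conj algebra_simps)
  then show ?thesis by (simp only: \<omega>_add \<omega>_sum finite_lessThan \<omega>_half_of_bool[OF q_pos])
qed

lemma bit_mod: "i < m \<Longrightarrow> bit (r mod 2 ^ m :: nat) i = bit r i"
  by (simp add: take_bit_eq_mod[symmetric] bit_take_bit_iff)

text \<open>The low \<open>m\<close> bits of \<open>r\<close> determine \<open>f\<close> and all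
  signs, since \<open>j \<alpha>\<close> and \<open>\<gamma>\<close> lie below \<open>m\<close>; the
  high bits enter only through the character.\<close>

lemma U_entry:
  assumes "r < 2 ^ (m + s)"
  shows "\<omega> q (F_pbf q p m s (gbf q m a) l (bit r) + real q / 2 *
      ((\<Sum>\<alpha><k. (of_bool (ds ! \<alpha>) + of_bool (bit t \<alpha>)) * of_bool (bit r (j \<alpha>)))
        + of_bool d * of_bool (bit r \<gamma>)))
    = A t (ds, d) (r mod 2 ^ m) * X p l (r div 2 ^ m)"
proof -
  have "gbf q m a (bit r) = gbf q m a (bit (r mod 2 ^ m))"
    by (rule gbf_cong) (simp add: bit_mod)
  moreover have "D t ds (r mod 2 ^ m)
     = (\<Prod>\<alpha><k. sg (ds ! \<alpha> \<and> bit r (j \<alpha>)) * sg (bit t \<alpha> \<and> bit r (j \<alpha>)))"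
    unfolding D_def by (intro prod.cong) (auto simp: bit_mod j_less)
  ultimately show ?thesis
    unfolding F_pbf_def \<omega>_add \<omega>_dot sum_bits_div[OF assms]
    by (simp add: A_def \<phi>_def X_def bit_mod \<gamma>_less)
qed

lemma V_entry:
  assumes "r < 2 ^ (m + s)"
  shows "\<omega> q (G_pbf q p m s (gbf q m a) l (bit r) + real q / 2 *
      ((\<Sum>\<alpha><k. (of_bool (ds ! \<alpha>) + of_bool (bit t \<alpha>)) * of_bool (\<not> bit r (j \<alpha>)))
        + of_bool (\<not> d) * of_bool (bit r \<gamma>)))
    = B t (ds, d) (r mod 2 ^ m) * X p l (r div 2 ^ m)"
proof -
  define v where "v = 2 ^ m - 1 - r mod 2 ^ m"
  have v: "bit v i \<longleftrightarrow> \<not> bit r i" if "i < m" for i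
    unfolding v_def by (subst bit_complement) (simp_all add: that bit_mod)
  have "gbf q m a (\<lambda>i. \<not> bit r i) = gbf q m a (bit v)"
    by (rule gbf_cong) (simp add: v)
  moreover have "D t ds v
     = (\<Prod>\<alpha><k. sg (ds ! \<alpha> \<and> \<not> bit r (j \<alpha>)) * sg (bit t \<alpha> \<and> \<not> bit r (j \<alpha>)))"
    unfolding D_def by (intro prod.cong) (auto simp: v j_less)
  moreover have "B t (ds, d) (r mod 2 ^ m) = \<phi> v * D t ds v * (sg (\<not> d) * sg (\<not> d \<and> bit v \<gamma>))"
    by (simp add: A_def B_def v_def)
  \<comment> \<open>\<open>V_set\<close> negates every variable of the low block except
    \<open>x \<gamma>\<close> in the last term. Evaluating that term at the complement
    \<open>v\<close> costs the factor \<open>sg (\<not> d)\<close>.\<close>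
  moreover have "sg (\<not> d) * sg (\<not> d \<and> bit v \<gamma>) = sg (\<not> d \<and> bit r \<gamma>)"
    by (auto simp: sg_def v \<gamma>_less)
  ultimately show ?thesis
    unfolding G_pbf_def \<omega>_add \<omega>_dot sum_bits_div[OF assms]
    by (simp add: \<phi>_def X_def)
qed

text \<open>The bound on \<open>p\<close> keeps the natural-number subtraction from truncating, so
  exactly \<open>p * 2 ^ m\<close> components survive.\<close>

lemma \<psi>_trunc_conv:
  assumes "p \<le> 2 ^ s"
  shows "\<psi>_trunc q (m + s) (2 ^ (m + s) - p * 2 ^ m) H = map (\<lambda>r. \<omega> q (H (bit r))) [0..<p * 2 ^ m]"
proof -
  have "p * 2 ^ m \<le> 2 ^ (m + s)" using assms by (simp add: power_add mult.commute)
  then show ?thesis by (simp add: \<psi>_trunc_def \<psi>_def take_map take_upt)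
qed

definition entry ::
  "nat \<Rightarrow> (nat \<times> nat) + (nat \<times> nat) \<Rightarrow> bool list \<times> bool \<Rightarrow> nat \<Rightarrow> complex" where
  "entry p = case_sum
     (\<lambda>(t, l) x r. A t x (r mod 2 ^ m) * X p l (r div 2 ^ m))
     (\<lambda>(t, l) x r. cnj (B t x (r mod 2 ^ m)) * cnj (X p l (r div 2 ^ m)))"

lemma code_family_conv:
  assumes "p \<le> 2 ^ s"
  shows "code_family q p m s (gbf q m a) k j \<gamma> ord i
    = map (\<lambda>x. map (entry p i x) [0..<p * 2 ^ m]) ord"
proof -
  have less: "r < 2 ^ (m + s)" if "r < p * 2 ^ m" for r
  proof -
    have "p * 2 ^ m \<le> 2 ^ (m + s)" using assms by (simp add: power_add mult.commute)
    then show ?thesis using that by simp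
  qed
  show ?thesis
  proof (cases i)
    case (Inl tl)
    obtain t l where tl: "tl = (t, l)" by fastforce
    show ?thesis
      unfolding code_family_def Inl tl Let_def sum.case prod.case \<psi>_code_def U_set_def map_map entry_def
      by (intro map_cong refl)
         (clarsimp simp only: o_apply split_paired_all prod.case \<psi>_trunc_conv[OF assms] map_map,
          intro map_cong refl, simp only: o_apply set_upt atLeastLessThan_iff U_entry[OF less] complex_cnj_mult)
  next
    case (Inr tl)
    obtain t l where tl: "tl = (t, l)" by fastforce
    show ?thesis
      unfolding code_family_def Inr tl Let_def sum.case prod.case \<psi>_code_cnj_def \<psi>_code_def V_set_def
        map_map entry_def
      by (intro map_cong refl)
         (clarsimp simp only: o_apply split_paired_all prod.case \<psi>_trunc_conv[OF assms] map_map,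
          intro map_cong refl, simp only: o_apply set_upt atLeastLessThan_iff V_entry[OF less] complex_cnj_mult)
  qed
qed

lemma xcorr_entry:
  assumes i: "i \<in> ({..<2 ^ k} \<times> {..<p}) <+> ({..<2 ^ k} \<times> {..<p})"
    and i': "i' \<in> ({..<2 ^ k} \<times> {..<p}) <+> ({..<2 ^ k} \<times> {..<p})"
    and \<tau>: "\<bar>\<tau>\<bar> < 2 ^ m"
  shows "xcorr (p * 2 ^ m) idx (entry p i) (entry p i') \<tau>
    = (if \<tau> = 0 \<and> i = i' then of_nat (2 ^ (k + 1) * (p * 2 ^ m)) else 0)"
proof -
  have X: "(\<Sum>b<p. X p l b * cnj (X p l' b)) = (if l = l' then of_nat p else 0)"
    if "l < p" "l' < p" for l l'
    unfolding X_def by (rule sum_\<omega>_orthogonal[OF q_pos that])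
  \<comment> \<open>Quantified over its own shift, because the case \<open>VU\<close> applies it at
    \<open>- \<tau>\<close> after exchanging the two codes.\<close>
  have mixed: "xcorr (p * 2 ^ m) idx (entry p (Inl x)) (entry p (Inr y)) \<tau> = 0" for x y \<tau>
    by (cases x; cases y) (auto simp: entry_def intro!: xcorr_tensor_eq_0 xcorr_A_cnj_B)
  consider (UU) t l t' l' where "i = Inl (t, l)" "i' = Inl (t', l')"
    | (VV) t l t' l' where "i = Inr (t, l)" "i' = Inr (t', l')"
    | (UV) x y where "i = Inl x" "i' = Inr y"
    | (VU) x y where "i = Inr x" "i' = Inl y"
    by (cases i; cases i') auto
  then show ?thesis
  proof cases
    case UU
    then have b: "t < 2 ^ k" "t' < 2 ^ k" "l < p" "l' < p" using i i' by auto
    have "xcorr (p * 2 ^ m) idx (entry p i) (entry p i') \<tau>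
      = (if \<tau> = 0 then (\<Sum>b<p. X p l b * cnj (X p l' b)) * xcorr (2 ^ m) idx (A t) (A t') 0 else 0)"
      unfolding entry_def UU sum.case prod.case
      by (rule xcorr_tensor_delta) (use \<tau> in \<open>auto simp: xcorr_A b\<close>)
    then show ?thesis by (simp add: X b xcorr_A UU)
  next
    case VV
    then have b: "t < 2 ^ k" "t' < 2 ^ k" "l < p" "l' < p" using i i' by auto
    have "xcorr (p * 2 ^ m) idx (entry p i) (entry p i') \<tau>
      = (if \<tau> = 0 then (\<Sum>b<p. cnj (X p l b) * cnj (cnj (X p l' b))) *
          xcorr (2 ^ m) idx (\<lambda>x u. cnj (B t x u)) (\<lambda>x u. cnj (B t' x u)) 0 else 0)"
      unfolding entry_def VV sum.case prod.case
      by (rule xcorr_tensor_delta) (use \<tau> in \<open>auto simp: xcorr_cnj_B xcorr_A b\<close>)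
    moreover have "(\<Sum>b<p. cnj (X p l b) * cnj (cnj (X p l' b))) = (if l = l' then of_nat p else 0)"
      using X[of l' l] b by (simp add: mult.commute)
    ultimately show ?thesis using b by (auto simp: xcorr_cnj_B xcorr_A VV)
  next
    case UV
    then show ?thesis by (simp add: mixed)
  next
    case VU
    then show ?thesis by (subst xcorr_commute) (simp add: mixed)
  qed
qed

lemma is_ZCCS_code_family:
  assumes "p \<le> 2 ^ s" "index_order k ord"
  shows "is_ZCCS (p * 2 ^ (k + 1)) (2 ^ m) (2 ^ (k + 1)) (p * 2 ^ m)
           (({..<2 ^ k} \<times> {..<p}) <+> ({..<2 ^ k} \<times> {..<p}))
           (code_family q p m s (gbf q m a) k j \<gamma> ord)"
proof -
  have ord: "distinct ord" "set ord = idx" using assms(2) by (auto simp: index_order_def idx_def)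
  have "card {ds :: bool list. length ds = k} = 2 ^ k"
    using card_lists_length_eq[of "UNIV :: bool set" k] by (simp add: card_UNIV_bool)
  then have "length ord = 2 ^ (k + 1)"
    using distinct_card[OF ord(1)] by (simp add: ord(2) idx_def card_cartesian_product UNIV_bool)
  then show ?thesis
    unfolding is_ZCCS_def code_family_conv[OF assms(1)] code_corr_map[OF ord(1)] ord(2)
    by (auto simp: card_Plus xcorr_entry simp del: of_nat_mult)
qed

end

section \<open>From the graph hypotheses to an ordered path\<close>

lemma path_code_if_path_graph:
  assumes "even q" "q \<ge> 2"
    and second: "second_order m a"
    and "inj_on j {..<k}" "j ` {..<k} \<subseteq> verts (gbf_graph m a)"
    and path: "is_path_graph (delete_verts (gbf_graph m a) (j ` {..<k})) vs"
    and weight: "\<forall>e \<in> edges (delete_verts (gbf_graph m a) (j ` {..<k})).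
           weight (gbf_graph m a) e = q div 2"
  shows "path_code q m k (hd vs) a j vs"
proof
  let ?E = "edges (delete_verts (gbf_graph m a) (j ` {..<k}))"
  show vs: "vs \<noteq> []" "distinct vs" "set vs = {..<m} - j ` {..<k}"
    using path by (auto simp: is_path_graph_def delete_verts_def gbf_graph_def)
  have E: "?E = {{vs ! i, vs ! Suc i} | i. Suc i < length vs}"
    using path by (simp add: is_path_graph_def)
  show "\<alpha> < k \<Longrightarrow> j \<alpha> < m" for \<alpha> using assms(5) by (auto simp: gbf_graph_def)
  show "a {vs ! i, vs ! Suc i} = q div 2" if "Suc i < length vs" for i
    using weight that unfolding E by (auto simp: gbf_graph_def)
  fix i S l
  assume i: "Suc i < length vs" and S: "S \<subseteq> {..<m}" "vs ! i \<in> S" "a S \<noteq> 0"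
    "S \<noteq> {vs ! i, vs ! Suc i}" and l: "l \<in> S"
  show "l \<in> j ` {..<k} \<union> set (take (Suc i) vs)"
  proof (cases "l = vs ! i \<or> l \<in> j ` {..<k}")
    case True
    then show ?thesis using i by (auto simp: take_Suc_conv_app_nth)
  next
    case False
    \<comment> \<open>Degree at most 2 forces \<open>S = {vs ! i, l}\<close>. Both vertices survive
      the deletion, so \<open>S\<close> is an edge of the path and joins consecutive
      vertices.\<close>
    have "card S \<le> 2" "finite S"
      using second S by (auto simp: second_order_def intro: finite_subset)
    moreover have "card {vs ! i, l} = 2" using False by auto
    ultimately have S_eq: "S = {vs ! i, l}"
      using S(2) l card_seteq[of S "{vs ! i, l}"] by auto
    have "vs ! i \<in> {..<m} - j ` {..<k}" using vs(3) i nth_mem[of i vs] by auto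
    then have "S \<in> ?E" using False S by (auto simp: S_eq delete_verts_def gbf_graph_def)
    then obtain n where n: "Suc n < length vs" "{vs ! i, l} = {vs ! n, vs ! Suc n}"
      using E S_eq by auto
    then have "(vs ! i = vs ! n \<and> l = vs ! Suc n) \<or> (vs ! i = vs ! Suc n \<and> l = vs ! n)"
      by (auto simp: doubleton_eq_iff)
    \<comment> \<open>The edge to the successor is excluded by the assumption on \<open>S\<close>,
      so \<open>l\<close> is the predecessor of \<open>vs ! i\<close>.\<close>
    then have "i = Suc n \<and> l = vs ! n"
      using vs(2) i n(1) S(4) S_eq by (auto simp: nth_eq_iff_index_eq)
    then show ?thesis using i by (auto simp: in_set_conv_nth intro!: exI[of _ n])
  qed
qed (use assms in auto)

text \<open>Allows \<open>\<gamma>\<close> to be either end of the path, although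
  \<open>path_code\<close> always starts at the head.\<close>

lemma is_path_graph_rev:
  assumes "is_path_graph G vs"
  shows "is_path_graph G (rev vs)"
proof -
  have "{{vs ! i, vs ! Suc i} | i. Suc i < length vs}
      = {{rev vs ! i, rev vs ! Suc i} | i. Suc i < length vs}" (is "?L = ?R")
  proof (intro equalityI subsetI)
    fix e assume "e \<in> ?L"
    then obtain i where "e = {vs ! i, vs ! Suc i}" "Suc i < length vs" by auto
    \<comment> \<open>The witness is the index of \<open>vs ! Suc i\<close> in the reversed list;
      \<open>vs ! i\<close> comes right after it.\<close>
    then show "e \<in> ?R"
      by (auto simp: rev_nth Suc_diff_Suc insert_commute intro!: exI[of _ "length vs - Suc (Suc i)"])
  next
    fix e assume "e \<in> ?R"
    then obtain i where "e = {rev vs ! i, rev vs ! Suc i}" "Suc i < length vs" by auto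
    then show "e \<in> ?L"
      by (auto simp: rev_nth Suc_diff_Suc insert_commute intro!: exI[of _ "length vs - Suc (Suc i)"])
  qed
  then show ?thesis using assms by (simp add: is_path_graph_def)
qed

theorem theorem1:
  fixes q m s p k \<gamma> :: nat
    and a :: "nat set \<Rightarrow> nat"
    and j :: "nat \<Rightarrow> nat"
    and vs :: "nat list"
    and ord :: "(bool list \<times> bool) list"
  assumes "even q" and "q \<ge> 2"
    and "m \<ge> 1" and "s \<ge> 1"
    and "prime p" and "2 \<le> p" and "p \<le> 2 ^ s"
    and "gbf_coeffs q m a" and "second_order m a"
    and "inj_on j {..<k}" and "j ` {..<k} \<subseteq> verts (gbf_graph m a)"
    and "is_path_graph (delete_verts (gbf_graph m a) (j ` {..<k})) vs"
    and "\<forall>e \<in> edges (delete_verts (gbf_graph m a) (j ` {..<k})).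
           weight (gbf_graph m a) e = q div 2"
    and "\<gamma> = hd vs \<or> \<gamma> = last vs"
    and "index_order k ord"
  shows "is_ZCCS (p * 2 ^ (k + 1)) (2 ^ m) (2 ^ (k + 1)) (p * 2 ^ m)
           (({..<2 ^ k} \<times> {..<p}) <+> ({..<2 ^ k} \<times> {..<p}))
           (code_family q p m s (gbf q m a) k j \<gamma> ord)"
proof -
  \<comment> \<open>The path is read from whichever end is \<open>\<gamma>\<close>, using that
    \<open>last vs\<close> is the head of \<open>rev vs\<close>.\<close>
  have "path_code q m k (hd ws) a j ws" if "ws = vs \<or> ws = rev vs" for ws
    using that assms is_path_graph_rev by (intro path_code_if_path_graph) auto
  then have "\<exists>ws. path_code q m k \<gamma> a j ws"
    using assms(14) by (metis hd_rev)
  then show ?thesis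
    using path_code.is_ZCCS_code_family assms(7,15) by blast
qed

end
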